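(* Let $k\ge 1$ and let $G$ be a $k$-connected graph which is triangle free or has minimum degree at least $\frac{3}{2}k-1$, and assume that $G$ is not isomorphic to $K_{k+1}$ in case $k\in\{1,2\}$. Then every spanning tree of $G$ contains at least two $k$-contractible edges.
   Context: All graphs are finite, simple and undirected. A graph $G$ is $k$-connected ($k\ge 1$) if $|V(G)|>k$ and $G-T$ is connected for every $T\subseteq V(G)$ with $|T|<k$. For an edge $e$, $G/e$ denotes the graph obtained by identifying the two endvertices of $e$ and simplifying (removing loops and multiple edges). An edge $e$ of a $k$-connected graph $G$ is $k$-contractible if $G/e$ is $k$-connected. *)

theory Defs
  imports Complex_Main
begin

text \<open>
  Undirected graphs are given by a vertex set and a set of two-element vertex sets. (In the digraph
  library a symmetric pair of arcs counts as a cycle, so its trees are not undirected trees.)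
\<close>

record 'a ugraph =
  verts :: "'a set"
  edges :: "'a set set"

definition simple_graph :: "'a ugraph \<Rightarrow> bool" where
  "simple_graph G \<longleftrightarrow> finite (verts G) \<and> (\<forall>e\<in>edges G. e \<subseteq> verts G \<and> card e = 2)"

definition adj :: "'a ugraph \<Rightarrow> 'a \<Rightarrow> 'a \<Rightarrow> bool" where
  "adj G u v \<longleftrightarrow> {u, v} \<in> edges G"

definition graph_connected :: "'a ugraph \<Rightarrow> bool" where
  "graph_connected G \<longleftrightarrow> verts G \<noteq> {} \<and> (\<forall>u\<in>verts G. \<forall>v\<in>verts G. (adj G)\<^sup>*\<^sup>* u v)"

definition delete_verts :: "'a ugraph \<Rightarrow> 'a set \<Rightarrow> 'a ugraph" where
  "delete_verts G S = \<lparr>verts = verts G - S, edges = {e \<in> edges G. e \<inter> S = {}}\<rparr>"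

definition k_connected :: "nat \<Rightarrow> 'a ugraph \<Rightarrow> bool" where
  "k_connected k G \<longleftrightarrow>
     card (verts G) > k \<and>
     (\<forall>S. S \<subseteq> verts G \<and> card S < k \<longrightarrow> graph_connected (delete_verts G S))"

text \<open>
  The vertices of \<open>G/e\<close> are the classes of the partition of the vertex set whose only
  non-singleton class is \<open>e\<close>. Edges form a set, so parallel edges are merged automatically;
  the condition that the classes differ discards the loop.
\<close>

definition contract_class :: "'a set \<Rightarrow> 'a \<Rightarrow> 'a set" where
  "contract_class e v = (if v \<in> e then e else {v})"

definition contract :: "'a ugraph \<Rightarrow> 'a set \<Rightarrow> 'a set ugraph" where
  "contract G e =
     \<lparr>verts = contract_class e ` verts G,
      edges = {{contract_class e x, contract_class e y} | x y.
                 {x, y} \<in> edges G \<and> contract_class e x \<noteq> contract_class e y}\<rparr>"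

definition contractible :: "nat \<Rightarrow> 'a ugraph \<Rightarrow> 'a set \<Rightarrow> bool" where
  "contractible k G e \<longleftrightarrow> e \<in> edges G \<and> k_connected k (contract G e)"

definition degree :: "'a ugraph \<Rightarrow> 'a \<Rightarrow> nat" where
  "degree G v = card {e \<in> edges G. v \<in> e}"

definition min_degree :: "'a ugraph \<Rightarrow> nat" where
  "min_degree G = Min (degree G ` verts G)"

text \<open>In a simple graph the three vertices below are automatically distinct.\<close>

definition triangle_free :: "'a ugraph \<Rightarrow> bool" where
  "triangle_free G \<longleftrightarrow> \<not> (\<exists>x y z. adj G x y \<and> adj G y z \<and> adj G x z)"

definition complete_graph :: "nat \<Rightarrow> nat ugraph" where
  "complete_graph n = \<lparr>verts = {..<n}, edges = {e. e \<subseteq> {..<n} \<and> card e = 2}\<rparr>"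

definition isomorphic :: "'a ugraph \<Rightarrow> 'b ugraph \<Rightarrow> bool" where
  "isomorphic G H \<longleftrightarrow>
     (\<exists>f. bij_betw f (verts G) (verts H) \<and>
          (\<forall>u\<in>verts G. \<forall>v\<in>verts G. adj G u v \<longleftrightarrow> adj H (f u) (f v)))"

definition is_cycle :: "'a ugraph \<Rightarrow> 'a list \<Rightarrow> bool" where
  "is_cycle G xs \<longleftrightarrow>
     length xs \<ge> 3 \<and> distinct xs \<and> set xs \<subseteq> verts G \<and>
     successively (adj G) xs \<and> adj G (last xs) (hd xs)"

definition is_tree :: "'a ugraph \<Rightarrow> bool" where
  "is_tree T \<longleftrightarrow> simple_graph T \<and> graph_connected T \<and> \<not> (\<exists>xs. is_cycle T xs)"

definition spanning_tree :: "'a ugraph \<Rightarrow> 'a ugraph \<Rightarrow> bool" where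
  "spanning_tree T G \<longleftrightarrow> is_tree T \<and> verts T = verts G \<and> edges T \<subseteq> edges G"

lemma simple_graph_delete_verts: "simple_graph G \<Longrightarrow> simple_graph (delete_verts G S)"
  by (auto simp: simple_graph_def delete_verts_def)

lemma simple_graph_contract: "simple_graph G \<Longrightarrow> simple_graph (contract G e)"
  by (fastforce simp: simple_graph_def contract_def card_2_iff)

lemma card_verts_contract:
  assumes G: "simple_graph G" and e: "e \<in> edges G"
  shows "card (verts (contract G e)) = card (verts G) - 1"
proof -
  have fin: "finite (verts G)" and sub: "e \<subseteq> verts G" and c: "card e = 2"
    using G e by (auto simp: simple_graph_def)
  have ne: "e \<noteq> {}" using c by auto
  have eq: "contract_class e ` verts G = insert e ((\<lambda>v. {v}) ` (verts G - e))"
    using ne sub by (auto simp: contract_class_def image_iff)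
  have "e \<notin> (\<lambda>v. {v}) ` (verts G - e)" using ne by auto
  then have "card (contract_class e ` verts G) = Suc (card (verts G - e))"
    unfolding eq using fin by (simp add: card_image)
  moreover have "card (verts G - e) = card (verts G) - 2"
    using fin sub c by (simp add: card_Diff_subset finite_subset)
  moreover have "card (verts G) \<ge> 2" using card_mono[OF fin sub] c by simp
  ultimately show ?thesis by (simp add: contract_def)
qed

end

theory Submission
  imports Defs
begin

text \<open>
  If \<open>G\<close> has at least \<open>k + 2\<close> vertices, an edge that is not \<open>k\<close>-contractible lies in a separator of
  order \<open>k\<close>, and by the triangle or degree condition each side of such a separator has at least
  \<open>k / 2\<close> vertices. Suppose all tree edges except possibly \<open>e0\<close> are not contractible. As \<open>e0\<close> cannot
  meet both sides of a separator, there is a side \<open>F\<close> disjoint from \<open>e0\<close> whose separator \<open>S\<close>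
  contains a tree edge; take \<open>F\<close> minimal. Some tree edge joins \<open>F\<close> to \<open>S\<close>, and it lies in a separator
  \<open>X\<close> of order \<open>k\<close>. By minimality the corners of \<open>X\<close> inside \<open>F\<close> are empty or have more than \<open>k\<close>
  neighbours, and counting the corners leads to a contradiction.
\<close>

section \<open>Separations and their order\<close>

text \<open>The sides need not be connected: each is a nonempty union of components of
  \<open>G - S\<close>, so a nonempty intersection of sides of two separations is again a
  side.\<close>

definition separation :: "'a ugraph \<Rightarrow> 'a set \<Rightarrow> 'a set \<Rightarrow> 'a set \<Rightarrow> bool" where
  "separation G F S B \<longleftrightarrow>
     F \<noteq> {} \<and> B \<noteq> {} \<and> F \<inter> S = {} \<and> F \<inter> B = {} \<and> S \<inter> B = {} \<and> F \<union> S \<union> B = verts G \<and>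
     (\<forall>x\<in>F. \<forall>y\<in>B. \<not> adj G x y)"

lemma adj_sym: "adj G u v \<Longrightarrow> adj G v u"
  by (simp add: adj_def insert_commute)

lemma adj_verts:
  assumes "simple_graph G" "adj G u v"
  shows "u \<in> verts G" "v \<in> verts G" "u \<noteq> v"
proof -
  have "{u, v} \<subseteq> verts G" "card {u, v} = 2"
    using assms unfolding simple_graph_def adj_def by blast+
  then show "u \<in> verts G" "v \<in> verts G" "u \<noteq> v" by auto
qed

lemma separation_sym: "separation G F S B \<Longrightarrow> separation G B S F"
  by (auto simp: separation_def dest: adj_sym)

lemma separation_subset:
  assumes "separation G F S B"
  shows "F \<subseteq> verts G" "S \<subseteq> verts G" "B \<subseteq> verts G"
  using assms by (auto simp: separation_def)

lemma separation_disjoint: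
  assumes "separation G F S B"
  shows "F \<inter> S = {}" "F \<inter> B = {}" "S \<inter> B = {}"
  using assms by (simp_all add: separation_def)

lemma separation_finite:
  assumes "simple_graph G" "separation G F S B"
  shows "finite F" "finite S" "finite B"
  using assms(1) separation_subset[OF assms(2)]
  by (simp_all add: simple_graph_def finite_subset)

lemma neighbours_subset: "simple_graph G \<Longrightarrow> {u. adj G v u} \<subseteq> verts G - {v}"
  by (auto dest: adj_verts)

text \<open>Some step of a walk must cross the boundary of \<open>F\<close>. This serves both for
  walks avoiding a separator and for paths in the spanning tree.\<close>

lemma rtranclp_exits:
  assumes "r\<^sup>*\<^sup>* u v" "u \<in> F" "v \<notin> F"
  obtains x y where "x \<in> F" "y \<notin> F" "r x y"
proof -
  have "v \<in> F \<or> (\<exists>x\<in>F. \<exists>y. y \<notin> F \<and> r x y)"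
    using assms(1,2) by (induction rule: rtranclp_induct) blast+
  then show thesis using assms(3) that by blast
qed

text \<open>If \<open>S\<close> had fewer than \<open>k\<close> vertices, a walk from
  \<open>F\<close> to \<open>B\<close> avoiding \<open>S\<close> would leave \<open>F\<close> by an
  edge ending in \<open>B\<close>.\<close>

lemma separation_card_ge:
  assumes "simple_graph G" "k_connected k G" "separation G F S B"
  shows "card S \<ge> k"
proof (rule ccontr)
  assume "\<not> card S \<ge> k"
  then have conn: "graph_connected (delete_verts G S)"
    using assms(2,3) unfolding k_connected_def separation_def by auto
  obtain u v where uv: "u \<in> F" "v \<in> B" using assms(3) unfolding separation_def by blast
  then have "(adj (delete_verts G S))\<^sup>*\<^sup>* u v" "v \<notin> F"
    using conn separation_subset[OF assms(3)] separation_disjoint[OF assms(3)]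
    unfolding graph_connected_def delete_verts_def select_convs by blast+
  then obtain x y where "x \<in> F" "y \<notin> F" "adj (delete_verts G S) x y"
    using uv(1) by (elim rtranclp_exits)
  moreover have "adj G x y" "y \<notin> S" if "adj (delete_verts G S) x y" for x y
    using that unfolding adj_def delete_verts_def by auto
  ultimately have "x \<in> F" "adj G x y" "y \<notin> S" "y \<notin> F" by blast+
  moreover from this have "y \<in> verts G" using adj_verts[OF assms(1)] by blast
  ultimately show False
    using assms(3) unfolding separation_def by blast
qed

lemma degree_eq_card_neighbours:
  assumes "simple_graph G"
  shows "degree G v = card {u. adj G v u}"
proof -
  have "{e \<in> edges G. v \<in> e} = (\<lambda>u. {v, u}) ` {u. adj G v u}"
  proof (intro set_eqI iffI)
    fix e assume e: "e \<in> {e \<in> edges G. v \<in> e}"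
    then have "card e = 2" using assms by (auto simp: simple_graph_def)
    then obtain u where "e = {v, u}" using e by (auto simp: card_2_iff)
    then show "e \<in> (\<lambda>u. {v, u}) ` {u. adj G v u}" using e by (auto simp: adj_def)
  qed (auto simp: adj_def)
  moreover have "inj_on (\<lambda>u. {v, u}) {u. adj G v u}"
    by (auto simp: inj_on_def doubleton_eq_iff)
  ultimately show ?thesis by (simp add: degree_def card_image)
qed

text \<open>Fewer than \<open>k\<close> neighbours would separate \<open>v\<close> from some
  remaining vertex, as there are more than \<open>k\<close> vertices.\<close>

lemma card_neighbours_ge:
  assumes "simple_graph G" "k_connected k G" "v \<in> verts G"
  shows "card {u. adj G v u} \<ge> k"
proof (rule ccontr)
  let ?N = "{u. adj G v u}"
  assume less: "\<not> card ?N \<ge> k"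
  have N: "?N \<subseteq> verts G" "v \<notin> ?N" using neighbours_subset[OF assms(1), of v] by blast+
  have fin: "finite (verts G)" using assms(1) by (simp add: simple_graph_def)
  have "card (insert v ?N) \<le> k" using less finite_subset[OF N(1) fin] N(2) by simp
  moreover have "card (verts G) > k" using assms(2) by (simp add: k_connected_def)
  ultimately have "verts G - insert v ?N \<noteq> {}"
    using N assms(3) by (metis Diff_eq_empty_iff fin card_mono finite_subset insert_subset leD le_trans)
  then have "separation G {v} ?N (verts G - insert v ?N)"
    using N assms(3) by (auto simp: separation_def)
  from separation_card_ge[OF assms(1,2) this] less show False by simp
qed

lemma min_degree_le_card_neighbours:
  assumes "simple_graph G" "v \<in> verts G"
  shows "min_degree G \<le> card {u. adj G v u}"
proof -
  have "min_degree G \<le> degree G v"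
    unfolding min_degree_def using assms by (simp add: simple_graph_def)
  then show ?thesis by (simp add: degree_eq_card_neighbours[OF assms(1)])
qed

section \<open>Lower bound on the sides\<close>

text \<open>Triangle free case: adjacent vertices of \<open>F\<close> have disjoint neighbourhoods
  inside \<open>F \<union> S\<close>, so \<open>2 * k \<le> card F + k\<close>; a vertex of
  \<open>F\<close> without neighbours in \<open>F\<close> is adjacent to all of \<open>S\<close>,
  and \<open>e\<close> closes a triangle. Degree case: a vertex of \<open>F\<close> has at most
  \<open>card F + k - 1\<close> neighbours.\<close>

lemma separation_side_large:
  assumes G: "simple_graph G" and conn: "k_connected k G"
    and cond: "triangle_free G \<or> real (min_degree G) \<ge> 3 / 2 * real k - 1"
    and sep: "separation G F S B" and S: "card S = k" and e: "e \<in> edges G" "e \<subseteq> S"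
  shows "2 * card F \<ge> k"
proof -
  obtain v where v: "v \<in> F" using sep by (auto simp: separation_def)
  have fin: "finite F" "finite S"
    using separation_finite[OF G sep] by simp_all
  have FS: "card (F \<union> S) = card F + k"
    using fin sep S by (simp add: card_Un_disjoint separation_def)
  have nb: "{u. adj G w u} \<subseteq> F \<union> S - {w}" if "w \<in> F" for w
    using that sep adj_verts[OF G] unfolding separation_def by blast
  have ge: "card {u. adj G w u} \<ge> k" if "w \<in> F" for w
    using card_neighbours_ge[OF G conn] that separation_subset(1)[OF sep] by blast
  from cond show ?thesis
  proof
    assume tf: "triangle_free G"
    show ?thesis
    proof (cases "\<exists>u\<in>F. adj G v u")
      case True
      then obtain u where u: "u \<in> F" "adj G v u" by blast
      have "{w. adj G v w} \<inter> {w. adj G u w} = {}"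
        using tf u(2) unfolding triangle_free_def by blast
      moreover have "{w. adj G v w} \<union> {w. adj G u w} \<subseteq> F \<union> S" using nb u(1) v by blast
      ultimately have "card {w. adj G v w} + card {w. adj G u w} \<le> card (F \<union> S)"
        using fin by (metis card_Un_disjoint card_mono finite_UnI finite_subset le_sup_iff)
      then show ?thesis using ge[OF v] ge[OF u(1)] FS by simp
    next
      case False
      then have "{u. adj G v u} \<subseteq> S" using nb v by blast
      then have "{u. adj G v u} = S" using ge[OF v] S fin(2) by (simp add: card_seteq)
      moreover obtain s t where "e = {s, t}"
        using e G by (auto simp: simple_graph_def card_2_iff)
      ultimately have "adj G v s" "adj G v t" "adj G s t" using e by (auto simp: adj_def)
      then show ?thesis using tf unfolding triangle_free_def by blast
    qed
  next
    assume deg: "real (min_degree G) \<ge> 3 / 2 * real k - 1"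
    have "card {u. adj G v u} \<le> card (F \<union> S - {v})"
      using nb[OF v] fin by (intro card_mono) auto
    also have "\<dots> = card F + k - 1" using v fin FS by simp
    finally have "card {u. adj G v u} \<le> card F + k - 1" .
    \<comment> \<open>As \<open>F\<close> is nonempty, the subtraction in
      \<open>card F + k - 1\<close> does not truncate.\<close>
    moreover have "card F > 0" using v fin by (auto simp: card_gt_0_iff)
    moreover have "min_degree G \<le> card {u. adj G v u}"
      using min_degree_le_card_neighbours[OF G] v separation_subset(1)[OF sep] by blast
    ultimately show ?thesis using deg by linarith
  qed
qed

section \<open>Non-contractible edges lie in separators\<close>

text \<open>A set \<open>S'\<close> of fewer than \<open>k\<close> vertices disconnecting
  \<open>G/e\<close> lifts to a separator of \<open>G\<close>. Lifting gains one vertex if the class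
  \<open>e\<close> is in \<open>S'\<close> and none otherwise, so \<open>k\<close>-connectedness
  forces \<open>e\<close> into \<open>S'\<close> and the order of the lift to be exactly
  \<open>k\<close>.\<close>

lemma noncontractible_edge_separation:
  assumes G: "simple_graph G" and conn: "k_connected k G" and large: "card (verts G) \<ge> k + 2"
    and e: "e \<in> edges G" "\<not> contractible k G e"
  obtains F S B where "separation G F S B" "card S = k" "e \<subseteq> S"
proof -
  let ?H = "contract G e" and ?c = "contract_class e"
  have fin: "finite (verts G)" and eV: "e \<subseteq> verts G" and e2: "card e = 2"
    using G e by (auto simp: simple_graph_def)
  have finH: "finite (verts ?H)" using fin by (simp add: contract_def)
  \<comment> \<open>Hence \<open>G/e\<close> can fail to be \<open>k\<close>-connected only through
    a disconnecting set.\<close>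
  have cH: "card (verts ?H) > k" using card_verts_contract[OF G e(1)] large by simp
  then obtain S' where S': "S' \<subseteq> verts ?H" "card S' < k"
      "\<not> graph_connected (delete_verts ?H S')"
    using e by (auto simp: contractible_def k_connected_def)
  \<comment> \<open>The empty graph also counts as not connected; once it is ruled out, two vertices
    without a walk between them exist.\<close>
  have "verts ?H - S' \<noteq> {}"
    using S' cH finH by (metis Diff_eq_empty_iff card_mono finite_subset leD le_trans less_imp_le)
  then obtain u' v' where uv: "u' \<in> verts ?H - S'" "v' \<in> verts ?H - S'"
      "\<not> (adj (delete_verts ?H S'))\<^sup>*\<^sup>* u' v'"
    using S'(3) by (auto simp: graph_connected_def delete_verts_def)
  \<comment> \<open>\<open>F'\<close> is the component of \<open>u'\<close>; \<open>S\<close> and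
    \<open>F\<close> are the preimages of \<open>S'\<close> and \<open>F'\<close>.\<close>
  define F' where "F' = {w. (adj (delete_verts ?H S'))\<^sup>*\<^sup>* u' w}"
  define S where "S = {v \<in> verts G. ?c v \<in> S'}"
  define F where "F = {v \<in> verts G - S. ?c v \<in> F'}"
  obtain u v where "u \<in> verts G" "u' = ?c u" "v \<in> verts G" "v' = ?c v"
    using uv(1,2) by (auto simp: contract_def)
  then have "u \<in> F" "v \<in> verts G - S - F"
    using uv by (auto simp: F_def S_def F'_def)
  moreover have "\<not> adj G x y" if x: "x \<in> F" and y: "y \<in> verts G - S - F" for x y
  proof
    assume "adj G x y"
    moreover have xy: "?c x \<in> F'" "?c y \<notin> F'" "?c x \<notin> S'" "?c y \<notin> S'"
      using x y by (auto simp: F_def S_def)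
    ultimately have "adj (delete_verts ?H S') (?c x) (?c y)"
      unfolding adj_def delete_verts_def contract_def by (simp, metis)
    then have "?c y \<in> F'" using xy(1) unfolding F'_def by (auto intro: rtranclp.rtrancl_into_rtrancl)
    with xy(2) show False by blast
  qed
  ultimately have sep: "separation G F S (verts G - S - F)"
    by (auto simp: separation_def F_def S_def)
  have kS: "k \<le> card S" by (rule separation_card_ge[OF G conn sep])
  have finS': "finite S'" using S'(1) finH finite_subset by blast
  have finS: "finite S" using fin by (simp add: S_def)
  \<comment> \<open>Outside \<open>e\<close> every class is a singleton, so \<open>S - e\<close>
    embeds in \<open>S' - {e}\<close>.\<close>
  have out: "card (S - e) \<le> card (S' - {e})"
  proof (rule card_inj_on_le[where f = "\<lambda>v. {v}"])
    show "(\<lambda>v. {v}) ` (S - e) \<subseteq> S' - {e}"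
      using e2 by (auto simp: S_def contract_class_def)
  qed (use finS' in auto)
  have "e \<in> S'"
  proof (rule ccontr)
    assume "e \<notin> S'"
    then have "S - e = S" "S' - {e} = S'" by (auto simp: S_def contract_class_def)
    then show False using out kS S'(2) by simp
  qed
  then have "e \<subseteq> S" using eV by (auto simp: S_def contract_class_def)
  have "card S = card (S - e) + 2"
    using \<open>e \<subseteq> S\<close> finS e2 by (metis card_Diff_subset card_mono finite_subset le_add_diff_inverse2)
  moreover have "card (S' - {e}) + 1 = card S'"
    using card_Suc_Diff1[OF finS' \<open>e \<in> S'\<close>] by simp
  ultimately have "card S = k" using out kS S'(2) by linarith
  then show thesis using sep \<open>e \<subseteq> S\<close> that by blast
qed

section \<open>The order of the graph\<close>

text \<open>Every vertex has at least \<open>k\<close> neighbours among only \<open>k\<close> other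
  vertices.\<close>

lemma complete_if_card_eq_Suc:
  assumes G: "simple_graph G" and conn: "k_connected k G" and card: "card (verts G) = k + 1"
    and uv: "u \<in> verts G" "v \<in> verts G" "u \<noteq> v"
  shows "adj G u v"
proof -
  have fin: "finite (verts G)" using G by (simp add: simple_graph_def)
  have "{w. adj G u w} \<subseteq> verts G - {u}" by (rule neighbours_subset[OF G])
  moreover have "card (verts G - {u}) \<le> card {w. adj G u w}"
    using card_neighbours_ge[OF G conn uv(1)] uv card by simp
  ultimately have "{w. adj G u w} = verts G - {u}" using fin by (simp add: card_seteq)
  then show ?thesis using uv by blast
qed

lemma isomorphic_complete_graph:
  assumes G: "simple_graph G" and card: "card (verts G) = n"
    and complete: "\<And>u v. u \<in> verts G \<Longrightarrow> v \<in> verts G \<Longrightarrow> u \<noteq> v \<Longrightarrow> adj G u v"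
  shows "isomorphic G (complete_graph n)"
proof -
  have "finite (verts G)" using G by (simp add: simple_graph_def)
  then obtain f where f: "bij_betw f (verts G) {0..<n}"
    using ex_bij_betw_finite_nat card by blast
  have "adj G u v \<longleftrightarrow> adj (complete_graph n) (f u) (f v)"
    if uv: "u \<in> verts G" "v \<in> verts G" for u v
  proof -
    have "adj G u v \<longleftrightarrow> u \<noteq> v" using complete[OF uv] adj_verts[OF G, of u v] by blast
    also have "\<dots> \<longleftrightarrow> f u \<noteq> f v" using f uv by (auto simp: bij_betw_def inj_on_def)
    also have "\<dots> \<longleftrightarrow> adj (complete_graph n) (f u) (f v)"
      using bij_betwE[OF f] uv by (auto simp: adj_def complete_graph_def card_2_iff doubleton_eq_iff)
    finally show ?thesis .
  qed
  then show ?thesis using f by (auto simp: isomorphic_def complete_graph_def lessThan_atLeast0)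
qed

text \<open>On \<open>k + 1\<close> vertices \<open>G\<close> would be complete. For
  \<open>k \<le> 2\<close> this is excluded by \<open>iso\<close>; for \<open>k \<ge> 3\<close>
  there is a triangle, and the minimum degree is at most \<open>k < 3 / 2 * k - 1\<close>.\<close>

lemma card_verts_ge:
  assumes k: "k \<ge> 1" and G: "simple_graph G" and conn: "k_connected k G"
    and cond: "triangle_free G \<or> real (min_degree G) \<ge> 3 / 2 * real k - 1"
    and iso: "k \<in> {1, 2} \<longrightarrow> \<not> isomorphic G (complete_graph (k + 1))"
  shows "card (verts G) \<ge> k + 2"
proof (rule ccontr)
  assume "\<not> card (verts G) \<ge> k + 2"
  then have card: "card (verts G) = k + 1" using conn by (simp add: k_connected_def)
  note complete = complete_if_card_eq_Suc[OF G conn card]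
  have "\<not> k \<in> {1, 2}" using iso isomorphic_complete_graph[OF G card complete] by blast
  then have k3: "k \<ge> 3" using k by auto
  have "card (verts G) \<ge> 3" using card k3 by simp
  then obtain X where X: "X \<subseteq> verts G" "card X = 3" by (meson obtain_subset_with_card_n)
  then obtain x y z where xyz: "X = {x, y, z}" "x \<noteq> y" "y \<noteq> z" "x \<noteq> z"
    by (auto simp: card_3_iff)
  then have "adj G x y" "adj G y z" "adj G x z" using X complete by auto
  then have "\<not> triangle_free G" unfolding triangle_free_def by blast
  moreover have "min_degree G \<le> k"
  proof -
    have "finite (verts G)" using G by (simp add: simple_graph_def)
    moreover have x: "x \<in> verts G" using X xyz by auto
    moreover have "{u. adj G x u} \<subseteq> verts G - {x}" by (rule neighbours_subset[OF G])
    ultimately have "card {u. adj G x u} \<le> card (verts G - {x})" by (intro card_mono) auto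
    then show ?thesis using min_degree_le_card_neighbours[OF G x] x card by simp
  qed
  ultimately show False using cond k3 by linarith
qed

section \<open>Corners of two crossing separations\<close>

text \<open>A vertex of the corner \<open>F \<inter> A\<close> has no neighbour in \<open>B\<close>
  by the first separation and none in \<open>C\<close> by the second, so its neighbours outside the
  corner lie in the three pieces of \<open>S \<union> X\<close> facing it.\<close>

lemma corner_separation:
  assumes "separation G F S B" "separation G A X C" "F \<inter> A \<noteq> {}"
  shows "separation G (F \<inter> A) (S \<inter> A \<union> S \<inter> X \<union> F \<inter> X) (B \<union> C)"
proof -
  note sep = assms(1,2)[unfolded separation_def]
  have "F \<inter> A \<union> (S \<inter> A \<union> S \<inter> X \<union> F \<inter> X) \<union> (B \<union> C) = verts G"
  proof
    show "F \<inter> A \<union> (S \<inter> A \<union> S \<inter> X \<union> F \<inter> X) \<union> (B \<union> C) \<subseteq> verts G"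
      using separation_subset[OF assms(1)] separation_subset[OF assms(2)] by blast
  next
    have "v \<in> F \<union> S \<union> B" "v \<in> A \<union> X \<union> C" if "v \<in> verts G" for v
      using sep that by simp_all
    then show "verts G \<subseteq> F \<inter> A \<union> (S \<inter> A \<union> S \<inter> X \<union> F \<inter> X) \<union> (B \<union> C)" by blast
  qed
  moreover have "(S \<inter> A \<union> S \<inter> X \<union> F \<inter> X) \<inter> (B \<union> C) = {}"
      "F \<inter> A \<inter> (S \<inter> A \<union> S \<inter> X \<union> F \<inter> X) = {}" "F \<inter> A \<inter> (B \<union> C) = {}"
    using separation_disjoint[OF assms(1)] separation_disjoint[OF assms(2)] by blast+
  moreover have "\<forall>x\<in>F. \<forall>y\<in>B. \<not> adj G x y" "\<forall>x\<in>A. \<forall>y\<in>C. \<not> adj G x y"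
    using sep by simp_all
  then have "\<forall>x\<in>F \<inter> A. \<forall>y\<in>B \<union> C. \<not> adj G x y" by blast
  moreover have "B \<union> C \<noteq> {}" using sep by simp
  ultimately show ?thesis using assms(3) unfolding separation_def by simp
qed

lemma card_corner:
  assumes "finite S" "finite X" "separation G F S B" "separation G A X C"
  shows "card (S \<inter> A \<union> S \<inter> X \<union> F \<inter> X) = card (S \<inter> A) + card (S \<inter> X) + card (F \<inter> X)"
proof -
  have "card (S \<inter> A \<union> S \<inter> X) = card (S \<inter> A) + card (S \<inter> X)"
    using assms by (intro card_Un_disjoint) (auto simp: separation_def)
  moreover have "card (S \<inter> A \<union> S \<inter> X \<union> F \<inter> X) = card (S \<inter> A \<union> S \<inter> X) + card (F \<inter> X)"
    using assms by (intro card_Un_disjoint) (auto simp: separation_def)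
  ultimately show ?thesis by simp
qed

text \<open>As \<open>A\<close>, \<open>X\<close>, \<open>C\<close> partition the vertices, this
  gives linear equations between the sizes of the nine cells of a crossing.\<close>

lemma card_split:
  assumes "finite M" "M \<subseteq> verts G" "separation G A X C"
  shows "card M = card (M \<inter> A) + card (M \<inter> X) + card (M \<inter> C)"
proof -
  have "M = M \<inter> A \<union> M \<inter> X \<union> M \<inter> C" using assms by (auto simp: separation_def)
  then have "card M = card (M \<inter> A \<union> M \<inter> X \<union> M \<inter> C)" by simp
  also have "\<dots> = card (M \<inter> A \<union> M \<inter> X) + card (M \<inter> C)"
    using assms by (intro card_Un_disjoint) (auto simp: separation_def)
  also have "card (M \<inter> A \<union> M \<inter> X) = card (M \<inter> A) + card (M \<inter> X)"
    using assms by (intro card_Un_disjoint) (auto simp: separation_def)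
  finally show ?thesis .
qed

text \<open>Otherwise each corner in \<open>F\<close> is empty or has a separator of order above
  \<open>k\<close>. The separators of opposite corners have orders adding up to
  \<open>card S + card X = 2 * k\<close>, so a nonempty corner in \<open>F\<close> forces the
  opposite corner in \<open>B\<close> to be empty.\<close>

lemma smaller_corner:
  assumes G: "simple_graph G" and conn: "k_connected k G"
    and FSB: "separation G F S B" "card S = k" and AXC: "separation G A X C" "card X = k"
    and large: "2 * card F \<ge> k" "2 * card B \<ge> k" "2 * card A \<ge> k" "2 * card C \<ge> k"
    and meet: "S \<inter> X \<noteq> {}"
  shows "(F \<inter> A \<noteq> {} \<and> card (S \<inter> A \<union> S \<inter> X \<union> F \<inter> X) = k) \<or>
    (F \<inter> C \<noteq> {} \<and> card (S \<inter> C \<union> S \<inter> X \<union> F \<inter> X) = k)"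
proof (rule ccontr)
  assume no: "\<not> ?thesis"
  have fin: "finite F" "finite S" "finite B" "finite A" "finite X" "finite C"
    and sub: "F \<subseteq> verts G" "S \<subseteq> verts G" "B \<subseteq> verts G"
      "A \<subseteq> verts G" "X \<subseteq> verts G" "C \<subseteq> verts G"
    using separation_finite[OF G FSB(1)] separation_finite[OF G AXC(1)]
      separation_subset[OF FSB(1)] separation_subset[OF AXC(1)] by simp_all
  note BSF = separation_sym[OF FSB(1)] and CXA = separation_sym[OF AXC(1)]
  have corner: "k \<le> card (S' \<inter> A' \<union> S' \<inter> X' \<union> F' \<inter> X')"
    if "separation G F' S' B'" "separation G A' X' C'" "F' \<inter> A' \<noteq> {}" for F' S' B' A' X' C'
    using separation_card_ge[OF G conn corner_separation[OF that]] .
  note splits = card_split[OF fin(1) sub(1) AXC(1)] card_split[OF fin(2) sub(2) AXC(1)]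
    card_split[OF fin(3) sub(3) AXC(1)] card_split[OF fin(4) sub(4) FSB(1)]
    card_split[OF fin(5) sub(5) FSB(1)] card_split[OF fin(6) sub(6) FSB(1)]
  note cards = card_corner[OF fin(2,5) FSB(1) AXC(1)] card_corner[OF fin(2,5) FSB(1) CXA]
    card_corner[OF fin(2,5) BSF AXC(1)] card_corner[OF fin(2,5) BSF CXA]
  have zero: "card (M \<inter> N) = 0 \<longleftrightarrow> M \<inter> N = {}" if "finite M" for M N :: "'a set"
    using that by simp
  have "card (S \<inter> X) > 0" using meet fin by (simp add: card_gt_0_iff)
  moreover have "card (B \<inter> A) = 0 \<or> k \<le> card (S \<inter> A) + card (S \<inter> X) + card (B \<inter> X)"
    using corner[OF BSF AXC(1)] cards zero[OF fin(3)] by metis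
  moreover have "card (B \<inter> C) = 0 \<or> k \<le> card (S \<inter> C) + card (S \<inter> X) + card (B \<inter> X)"
    using corner[OF BSF CXA] cards zero[OF fin(3)] by metis
  moreover have "card (F \<inter> A) = 0 \<or> k < card (S \<inter> A) + card (S \<inter> X) + card (F \<inter> X)"
    using corner[OF FSB(1) AXC(1)] cards zero[OF fin(1)] no by (metis nat_less_le)
  moreover have "card (F \<inter> C) = 0 \<or> k < card (S \<inter> C) + card (S \<inter> X) + card (F \<inter> X)"
    using corner[OF FSB(1) CXA] cards zero[OF fin(1)] no by (metis nat_less_le)
  \<comment> \<open>If both corners in \<open>F\<close> are nonempty, then
    \<open>B \<subseteq> X\<close>, and \<open>S \<inter> A\<close> and \<open>S \<inter> C\<close>
    are both larger than \<open>B\<close>, so \<open>S\<close> is too large. If only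
    \<open>F \<inter> A\<close> is nonempty, then \<open>C \<subseteq> S\<close> and
    \<open>F \<inter> X\<close> is larger than \<open>C\<close>; so \<open>B \<inter> X\<close> has
    fewer than \<open>k / 2\<close> vertices and \<open>B \<inter> A\<close> must be empty, making
    \<open>B\<close> too small. The case of \<open>F \<inter> C\<close> is symmetric. If both are
    empty, then \<open>F \<subseteq> X\<close>; as \<open>S\<close> meets \<open>X\<close>,
    \<open>B\<close> has a nonempty corner, say in \<open>A\<close>, so \<open>S \<inter> A\<close>
    has at least \<open>k / 2\<close> vertices. Then \<open>S \<inter> C\<close> has fewer, so
    \<open>C\<close> meets \<open>B\<close>, which requires \<open>k / 2\<close> vertices in
    \<open>S \<inter> C\<close> too.\<close>
  ultimately show False
    using splits[unfolded Int_commute[of A] Int_commute[of X] Int_commute[of C]] large FSB(2) AXC(2)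
    by linarith
qed

section \<open>A minimal side avoiding the exceptional edge\<close>

theorem theorem2:
  fixes G T :: "'a ugraph" and k :: nat
  assumes "k \<ge> 1"
    and "simple_graph G"
    and "k_connected k G"
    and "triangle_free G \<or> real (min_degree G) \<ge> 3 / 2 * real k - 1"
    and "k \<in> {1, 2} \<longrightarrow> \<not> isomorphic G (complete_graph (k + 1))"
    and "spanning_tree T G"
  shows "card {e \<in> edges T. contractible k G e} \<ge> 2"
proof (rule ccontr)
  let ?E = "{e \<in> edges T. contractible k G e}"
  assume few: "\<not> card ?E \<ge> 2"
  note G = assms(2) and conn = assms(3) and cond = assms(4)
  have large: "card (verts G) \<ge> k + 2" by (rule card_verts_ge[OF assms(1-5)])
  have T: "graph_connected T" "verts T = verts G" "edges T \<subseteq> edges G"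
    using assms(6) by (auto simp: spanning_tree_def is_tree_def)
  have fin: "finite (verts G)" using G by (simp add: simple_graph_def)
  have "edges T \<subseteq> Pow (verts G)" using T(3) G by (auto simp: simple_graph_def)
  then have "finite (edges T)" using fin by (meson finite_Pow_iff finite_subset)
  then have "finite ?E" by simp
  \<comment> \<open>\<open>e0\<close> is the only contractible tree edge if there is one, and
    otherwise \<open>{}\<close>, which meets no side.\<close>
  then obtain e0 where e0: "e0 = {} \<or> e0 \<in> edges G" "\<And>e. e \<in> ?E \<Longrightarrow> e = e0"
  proof (cases "?E = {}")
    case False
    then obtain e where "e \<in> ?E" by blast
    moreover have "card ?E \<le> Suc 0" using few by simp
    ultimately show ?thesis using that[of e] T(3) \<open>finite ?E\<close> card_le_Suc0_iff_eq by blast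
  next
    case True
    then show ?thesis by (intro that[of "{}"]) auto
  qed
  have exits: "\<exists>x\<in>F. \<exists>y. y \<notin> F \<and> adj T x y" if "u \<in> F" "v \<notin> F" "u \<in> verts G" "v \<in> verts G" for u v F
  proof -
    have "(adj T)\<^sup>*\<^sup>* u v" using T that by (simp add: graph_connected_def)
    then show ?thesis using that by (elim rtranclp_exits) blast+
  qed
  define good where "good F \<longleftrightarrow> F \<inter> e0 = {} \<and>
    (\<exists>S B. separation G F S B \<and> card S = k \<and> (\<exists>e\<in>edges T. e \<subseteq> S))" for F
  have ex: "\<exists>F. good F"
  proof -
    have "card e0 \<le> 2" using e0(1) G by (auto simp: simple_graph_def)
    moreover have "finite e0" using e0(1) G fin by (auto simp: simple_graph_def dest: finite_subset)
    \<comment> \<open>At least three vertices leave some \<open>u\<close> off \<open>e0\<close>, so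
      every tree edge at \<open>u\<close> is non-contractible.\<close>
    ultimately have "\<not> verts G \<subseteq> e0" using large assms(1) card_mono[of e0 "verts G"] by linarith
    then obtain u where u: "u \<in> verts G" "u \<notin> e0" by blast
    have "verts G \<noteq> {u}" using large by auto
    then obtain v where v: "v \<in> verts G" "v \<noteq> u" using u by blast
    obtain w where w: "adj T u w" using exits[of u "{u}" v] u v by auto
    then have e: "{u, w} \<in> edges G" "\<not> contractible k G {u, w}"
      using T(3) e0(2)[of "{u, w}"] u(2) by (auto simp: adj_def)
    obtain F S B where sep: "separation G F S B" "card S = k" "{u, w} \<subseteq> S"
      by (rule noncontractible_edge_separation[OF G conn large e])
    have "F \<inter> e0 = {} \<or> B \<inter> e0 = {}"
    proof (rule ccontr)
      assume "\<not> ?thesis"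
      then obtain x y where xy: "x \<in> F" "y \<in> B" "x \<in> e0" "y \<in> e0" by blast
      then have "e0 \<in> edges G" "x \<noteq> y" using e0(1) sep(1) by (auto simp: separation_def)
      moreover from this have "e0 = {x, y}" using xy G by (auto simp: simple_graph_def card_2_iff)
      ultimately show False using sep(1) xy(1,2) by (auto simp: separation_def adj_def)
    qed
    then show ?thesis
      using sep separation_sym[OF sep(1)] w unfolding good_def adj_def by blast
  qed
  obtain F where F: "good F" and minimal: "\<And>F'. good F' \<Longrightarrow> card F \<le> card F'"
    using ex_has_least_nat[of good _ card] ex by blast
  obtain S B e where FSB: "separation G F S B" "card S = k" and e: "e \<in> edges T" "e \<subseteq> S"
    and Fe0: "F \<inter> e0 = {}"
    using F unfolding good_def by blast
  obtain f b where "f \<in> F" "b \<in> B" "b \<notin> F" using FSB(1) unfolding separation_def by blast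
  \<comment> \<open>A tree edge leaving \<open>F\<close> ends in \<open>S\<close>, and it differs
    from \<open>e0\<close> because \<open>x\<close> is not in \<open>e0\<close>.\<close>
  then obtain x y where xy: "x \<in> F" "y \<notin> F" "adj T x y"
    using exits[of f F b] separation_subset[OF FSB(1)] by blast
  then have xyG: "{x, y} \<in> edges G" "\<not> contractible k G {x, y}"
    using T(3) e0(2)[of "{x, y}"] Fe0 by (auto simp: adj_def)
  then have y: "y \<in> S"
    using xy(1,2) FSB(1) adj_verts[OF G, of x y] by (auto simp: separation_def adj_def)
  obtain A X C where AXC: "separation G A X C" "card X = k" "{x, y} \<subseteq> X"
    by (rule noncontractible_edge_separation[OF G conn large xyG])
  have eG: "e \<in> edges G" using e(1) T(3) by blast
  \<comment> \<open>The corner would be a good side, its separator containing the tree edge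
    \<open>{x, y}\<close>; it is smaller than \<open>F\<close> because \<open>x\<close> lies in
    \<open>F \<inter> X\<close>.\<close>
  have corner: False
    if "separation G A' X C'" "F \<inter> A' \<noteq> {}" "card (S \<inter> A' \<union> S \<inter> X \<union> F \<inter> X) = k" for A' C'
  proof -
    have "{x, y} \<subseteq> S \<inter> A' \<union> S \<inter> X \<union> F \<inter> X" using xy(1) y AXC(3) by blast
    then have "good (F \<inter> A')"
      using corner_separation[OF FSB(1) that(1,2)] that(3) xy(3) Fe0 unfolding good_def adj_def by blast
    moreover have "F \<inter> A' \<subset> F" using xy(1) AXC(3) that(1) by (auto simp: separation_def)
    moreover have "finite F" by (rule separation_finite(1)[OF G FSB(1)])
    ultimately show False using minimal psubset_card_mono by (metis leD)
  qed
  \<comment> \<open>The edges \<open>e\<close> in \<open>S\<close> and \<open>{x, y}\<close> in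
    \<open>X\<close> make the bound on the sides applicable to both separations.\<close>
  have large_sides: "2 * card F \<ge> k" "2 * card B \<ge> k" "2 * card A \<ge> k" "2 * card C \<ge> k"
    using separation_side_large[OF G conn cond _ FSB(2) eG e(2)]
      separation_side_large[OF G conn cond _ AXC(2) xyG(1) AXC(3)]
      FSB(1) AXC(1) separation_sym by blast+
  have "S \<inter> X \<noteq> {}" using y AXC(3) by blast
  from smaller_corner[OF G conn FSB AXC(1,2) large_sides this] corner
  show False using AXC(1) separation_sym by blast
qed

end
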